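(* Let $n$ and $k$ be positive integers with $5k\le n$. Then there exists a latin square of order $n$ containing an indivisible $k$-plex.
   Context: A latin square of order $n$ is an $n\times n$ array of $n$ symbols in which each symbol occurs exactly once in each row and column. A $k$-plex in a latin square of order $n$ is a set of $kn$ cells containing exactly $k$ cells from each row, exactly $k$ cells from each column, and exactly $k$ occurrences of each symbol. A $k$-plex is indivisible if it contains no $c$-plex for any $c$ with $0<c<k$. *)

theory Defs
  imports Main
begin

definition latin_square :: "nat \<Rightarrow> (nat \<Rightarrow> nat \<Rightarrow> nat) \<Rightarrow> bool" where
  "latin_square n L \<longleftrightarrow>
     (\<forall>i<n. \<forall>j<n. L i j < n) \<and>
     (\<forall>i<n. \<forall>s<n. card {j. j < n \<and> L i j = s} = 1) \<and>
     (\<forall>j<n. \<forall>s<n. card {i. i < n \<and> L i j = s} = 1)"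

definition is_plex :: "nat \<Rightarrow> (nat \<Rightarrow> nat \<Rightarrow> nat) \<Rightarrow> nat \<Rightarrow> (nat \<times> nat) set \<Rightarrow> bool" where
  "is_plex n L k P \<longleftrightarrow>
     P \<subseteq> {0..<n} \<times> {0..<n} \<and>
     card P = k * n \<and>
     (\<forall>i<n. card {j. (i, j) \<in> P} = k) \<and>
     (\<forall>j<n. card {i. (i, j) \<in> P} = k) \<and>
     (\<forall>s<n. card {(i, j). (i, j) \<in> P \<and> L i j = s} = k)"

definition indivisible_plex :: "nat \<Rightarrow> (nat \<Rightarrow> nat \<Rightarrow> nat) \<Rightarrow> nat \<Rightarrow> (nat \<times> nat) set \<Rightarrow> bool" where
  "indivisible_plex n L k P \<longleftrightarrow>
     is_plex n L k P \<and> (\<forall>c Q. 0 < c \<and> c < k \<and> Q \<subseteq> P \<longrightarrow> \<not> is_plex n L c Q)"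

end

theory Submission
  imports Defs
begin

text \<open>
  A \<open>k\<close>-plex is indivisible as soon as its restriction to a latin subsquare is an indivisible
  \<open>k\<close>-plex of the subsquare. For \<open>k \<ge> 2\<close> the subsquare has order \<open>2k\<close>: it is the cyclic table
  \<open>i + j\<close> modulo \<open>2k\<close>, altered by a trade so that row 0 of the plex consists of the cells with
  symbol \<open>j + 1\<close>, while all other cells of the plex still have symbol \<open>i + j\<close> modulo \<open>k\<close>.
  Summing \<open>i + j - L i j\<close> over a \<open>c\<close>-plex inside it gives both 0 and \<open>-c\<close> modulo \<open>k\<close>,
  hence \<open>k\<close> divides \<open>c\<close>. For \<open>k = 1\<close> the subsquare has order 1.

  A subsquare of order \<open>m\<close> is then completed to order \<open>n = r + m\<close> by prolongation of a square of
  order \<open>r\<close> whose cyclic diagonals are transversals, apart from \<open>m\<close> of them which are filled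
  with the symbols of the subsquare. Any \<open>k\<close> of the \<open>r - m\<close> transversals complete the plex, so
  \<open>n \<ge> 2m + k\<close> suffices, which is \<open>5k\<close> for \<open>m = 2k\<close>.
\<close>

section \<open>Counting in latin squares and plexes\<close>

text \<open>An injective self-map of a finite set attains every value exactly once.\<close>

lemma latin_squareI:
  assumes closed: "\<And>i j. i < n \<Longrightarrow> j < n \<Longrightarrow> L i j < n"
    and rows: "\<And>i. i < n \<Longrightarrow> inj_on (L i) {..<n}"
    and cols: "\<And>j. j < n \<Longrightarrow> inj_on (\<lambda>i. L i j) {..<n}"
  shows "latin_square n L"
proof -
  have one: "card {x. x < n \<and> f x = s} = 1"
    if inj: "inj_on f {..<n}" and into: "f ` {..<n} \<subseteq> {..<n}" and s: "s < n" for f s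
  proof -
    have "f ` {..<n} = {..<n}"
      using inj into by (simp add: endo_inj_surj)
    then obtain x where "x < n" "f x = s"
      using s by (metis imageE lessThan_iff)
    then have "{x. x < n \<and> f x = s} = {x}"
      using inj by (auto simp: inj_on_def)
    then show ?thesis by simp
  qed
  show ?thesis
    unfolding latin_square_def
    by (intro conjI allI impI one rows cols) (use closed in auto)
qed

lemma latin_square_less: "latin_square n L \<Longrightarrow> i < n \<Longrightarrow> j < n \<Longrightarrow> L i j < n"
  by (simp add: latin_square_def)

lemma latin_square_row_ex:
  assumes "latin_square n L" "i < n" "s < n"
  shows "\<exists>j<n. L i j = s"
proof -
  have "card {j. j < n \<and> L i j = s} = 1"
    using assms by (simp add: latin_square_def)
  then show ?thesis
    by (metis (mono_tags, lifting) card_1_singletonE mem_Collect_eq singletonI)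
qed

lemma latin_square_row_inj:
  assumes "latin_square n L" "i < n"
  shows "inj_on (L i) {..<n}"
proof (rule inj_onI)
  fix x y assume xy: "x \<in> {..<n}" "y \<in> {..<n}" "L i x = L i y"
  then have "card {j. j < n \<and> L i j = L i y} = 1"
    using assms by (auto simp: latin_square_def)
  then obtain z where "{j. j < n \<and> L i j = L i y} = {z}"
    by (rule card_1_singletonE)
  with xy show "x = y" by (metis (mono_tags, lifting) lessThan_iff mem_Collect_eq singletonD)
qed

lemma latin_square_col_inj:
  assumes "latin_square n L" "j < n"
  shows "inj_on (\<lambda>i. L i j) {..<n}"
proof (rule inj_onI)
  fix x y assume xy: "x \<in> {..<n}" "y \<in> {..<n}" "L x j = L y j"
  then have "card {i. i < n \<and> L i j = L y j} = 1"
    using assms by (auto simp: latin_square_def)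
  then obtain z where "{i. i < n \<and> L i j = L y j} = {z}"
    by (rule card_1_singletonE)
  with xy show "x = y" by (metis (mono_tags, lifting) lessThan_iff mem_Collect_eq singletonD)
qed

text \<open>A symbol occurs at most once in a row, so projection to the rows is injective on its
  cells. This lets symbol counts be done as counts of rows.\<close>

lemma card_symbol_cells:
  assumes "latin_square n L" "P \<subseteq> {0..<n} \<times> {0..<n}"
  shows "card {(i, j). (i, j) \<in> P \<and> L i j = s} = card {i. \<exists>j. (i, j) \<in> P \<and> L i j = s}"
proof -
  let ?C = "{(i, j). (i, j) \<in> P \<and> L i j = s}"
  have "inj_on fst ?C"
  proof (rule inj_onI, clarify)
    fix a b a' b'
    assume "(a, b) \<in> P" "(a', b') \<in> P" "L a' b' = L a b" and [simp]: "fst (a, b) = fst (a', b')"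
      and "s = L a b"
    moreover from this have "a < n" "b < n" "b' < n" using assms(2) by auto
    ultimately show "a = a' \<and> b = b'"
      using latin_square_row_inj[OF assms(1), of a] by (auto simp: inj_on_def)
  qed
  then have "card (fst ` ?C) = card ?C" by (rule card_image)
  moreover have "fst ` ?C = {i. \<exists>j. (i, j) \<in> P \<and> L i j = s}" by force
  ultimately show ?thesis by simp
qed

lemma is_plexI:
  assumes sub: "P \<subseteq> {0..<n} \<times> {0..<n}" and L: "latin_square n L"
    and rows: "\<And>i. i < n \<Longrightarrow> card {j. (i, j) \<in> P} = k"
    and cols: "\<And>j. j < n \<Longrightarrow> card {i. (i, j) \<in> P} = k"
    and syms: "\<And>s. s < n \<Longrightarrow> card {i. \<exists>j. (i, j) \<in> P \<and> L i j = s} = k"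
  shows "is_plex n L k P"
proof -
  have P: "P = Sigma {0..<n} (\<lambda>i. {j. (i, j) \<in> P})" using sub by auto
  have fin: "finite {j. (i, j) \<in> P}" for i
    by (rule finite_subset[of _ "{0..<n}"]) (use sub in auto)
  have "card P = (\<Sum>i\<in>{0..<n}. card {j. (i, j) \<in> P})"
    by (subst P, subst card_SigmaI) (use fin in auto)
  also have "\<dots> = k * n" using rows by simp
  finally show ?thesis
    using assms card_symbol_cells[OF L sub] by (simp add: is_plex_def)
qed

lemma sum_equal_fibres:
  assumes "finite Q" "f ` Q \<subseteq> {..<n}" "\<And>y. y < n \<Longrightarrow> card {x \<in> Q. f x = y} = c"
  shows "(\<Sum>x\<in>Q. int (f x)) = int c * (\<Sum>y<n. int y)"
proof -
  have "(\<Sum>x\<in>Q. int (f x)) = (\<Sum>y<n. \<Sum>x | x \<in> Q \<and> f x = y. int (f x))"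
    by (rule sum.group[symmetric]) (use assms in auto)
  also have "\<dots> = (\<Sum>y<n. int c * int y)"
    using assms(3) by (intro sum.cong) (auto simp: mult.commute)
  finally show ?thesis by (simp add: sum_distrib_left)
qed

lemma card_row_fibre: "card {x \<in> Q. fst x = i} = card {j. (i, j) \<in> Q}"
proof -
  have "{x \<in> Q. fst x = i} = Pair i ` {j. (i, j) \<in> Q}" by force
  then show ?thesis by (simp add: card_image inj_on_def)
qed

lemma card_col_fibre: "card {x \<in> Q. snd x = j} = card {i. (i, j) \<in> Q}"
proof -
  have "{x \<in> Q. snd x = j} = (\<lambda>i. (i, j)) ` {i. (i, j) \<in> Q}" by force
  then show ?thesis by (simp add: card_image inj_on_def)
qed

text \<open>Useful when \<open>L\<close> is close to the addition table of a cyclic group, so that most summands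
  vanish; known there as the Delta lemma.\<close>
lemma plex_delta_sum:
  assumes "is_plex n L c Q" "latin_square n L"
  shows "(\<Sum>(i, j)\<in>Q. int i + int j - int (L i j)) = int c * (\<Sum>y<n. int y)"
proof -
  have sub: "Q \<subseteq> {0..<n} \<times> {0..<n}" using assms by (simp add: is_plex_def)
  have fin: "finite Q" by (rule finite_subset[OF sub]) simp
  have R: "(\<Sum>x\<in>Q. int (fst x)) = int c * (\<Sum>y<n. int y)"
    by (rule sum_equal_fibres)
      (use assms sub fin in \<open>auto simp: is_plex_def card_row_fibre\<close>)
  have C: "(\<Sum>x\<in>Q. int (snd x)) = int c * (\<Sum>y<n. int y)"
    by (rule sum_equal_fibres)
      (use assms sub fin in \<open>auto simp: is_plex_def card_col_fibre\<close>)
  have S: "(\<Sum>x\<in>Q. int (case x of (i, j) \<Rightarrow> L i j)) = int c * (\<Sum>y<n. int y)"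
  proof (rule sum_equal_fibres[OF fin])
    show "(\<lambda>(i, j). L i j) ` Q \<subseteq> {..<n}"
      using sub latin_square_less[OF assms(2)] by auto
    fix y assume "y < n"
    moreover have "{x \<in> Q. (case x of (i, j) \<Rightarrow> L i j) = y} = {(i, j). (i, j) \<in> Q \<and> L i j = y}"
      by auto
    ultimately show "card {x \<in> Q. (case x of (i, j) \<Rightarrow> L i j) = y} = c"
      using assms(1) by (simp add: is_plex_def)
  qed
  have "(\<Sum>(i, j)\<in>Q. int i + int j - int (L i j))
      = (\<Sum>x\<in>Q. int (fst x) + int (snd x) - int (case x of (i, j) \<Rightarrow> L i j))"
    by (intro sum.cong) auto
  also have "\<dots> = int c * (\<Sum>y<n. int y)"
    unfolding sum_subtractf sum.distrib R C S by simp
  finally show ?thesis .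
qed

lemma card_permuted:
  assumes "inj_on f {..<n}" "f ` {..<n} \<subseteq> {..<n}"
  shows "card {x. x < n \<and> R (f x)} = card {x. x < (n::nat) \<and> R x}"
proof -
  have "{x. x < n \<and> R x} = {x \<in> f ` {..<n}. R x}"
    using assms by (simp add: endo_inj_surj)
  also have "\<dots> = f ` {x. x < n \<and> R (f x)}" by blast
  finally have eq: "{x. x < n \<and> R x} = f ` {x. x < n \<and> R (f x)}" .
  have "inj_on f {x. x < n \<and> R (f x)}"
    by (rule inj_on_subset[OF assms(1)]) auto
  then show ?thesis unfolding eq by (rule card_image[symmetric])
qed

lemma card_translated: "card {x. r \<le> x \<and> R (x - r)} = card {x. R (x::nat)}"
proof -
  have "{x. r \<le> x \<and> R (x - r)} = (+) r ` {x. R x}"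
    by (force simp: le_iff_add)
  then show ?thesis by (simp add: card_image)
qed

lemma card_even_odd:
  fixes k :: nat
  shows "card {i. i < 2 * k \<and> T i} = (\<Sum>u<k. of_bool (T (2 * u)) + of_bool (T (2 * u + 1)))"
proof -
  have "(\<Sum>i<2 * k. of_bool (T i) :: nat)
      = (\<Sum>u<k. of_bool (T (2 * u)) + of_bool (T (2 * u + 1)))"
    by (induction k) simp_all
  moreover have "(\<Sum>i<2 * k. of_bool (T i) :: nat) = card ({..<2 * k} \<inter> {i. T i})"
    by (simp add: of_bool_def sum.If_cases)
  moreover have "{i. i < 2 * k \<and> T i} = {..<2 * k} \<inter> {i. T i}" by auto
  ultimately show ?thesis by simp
qed

section \<open>A square of order 2k containing an indivisible k-plex\<close>

text \<open>The Cayley table of the integers modulo \<open>2k\<close>, modified by a latin trade in rows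
  0, 1 and \<open>k\<close>. Modulo \<open>k\<close>, the trade changes only entries of rows 0 and 1.\<close>
definition trade_square :: "nat \<Rightarrow> nat \<Rightarrow> nat \<Rightarrow> nat" where
  "trade_square k i j =
    (if i = 0 \<and> j < k then j + 1
     else if i = 0 \<and> j = k then 0
     else if i = 1 \<and> j = 0 then k
     else if i = 1 \<and> j < k then j
     else if i = k \<and> j = 0 then 0
     else if i = k \<and> j = k then k
     else if i + j < 2 * k then i + j
     else i + j - 2 * k)"

text \<open>For even \<open>k\<close> the plex must contain exactly one of the two traded cells of row \<open>k\<close>, for odd
  \<open>k\<close> both or none; this forces the dependence on parity.\<close>
definition in_half :: "nat \<Rightarrow> nat \<Rightarrow> bool" where
  "in_half k x \<longleftrightarrow> x = 0 \<or> k + 1 < x \<or> x = (if even k then k + 1 else k)"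

text \<open>For \<open>u < k\<close> and \<open>s < 2 * k\<close> this is \<open>s - 2 * u\<close>
  modulo \<open>2 * k\<close>. On unaltered cells of rows \<open>2 * u\<close> and
  \<open>2 * u + 1\<close> it returns the column, respectively its cyclic successor, so within such
  a row membership is governed by the column.\<close>

definition shift_down :: "nat \<Rightarrow> nat \<Rightarrow> nat \<Rightarrow> nat" where
  "shift_down k u s = (if 2 * u \<le> s then s - 2 * u else s + 2 * k - 2 * u)"

text \<open>Rows \<open>2u\<close> and \<open>2u + 1\<close> select complementary sets of symbols, so that each such pair of rows
  uses every symbol once.\<close>
definition chosen :: "nat \<Rightarrow> nat \<Rightarrow> nat \<Rightarrow> bool" where
  "chosen k i s \<longleftrightarrow>
    (even i \<longleftrightarrow> (in_half k (shift_down k (i div 2) s) \<longleftrightarrow> i div 2 \<le> k div 2))"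

text \<open>Row 0 takes exactly those of its cells whose entry the trade changes modulo
  \<open>k\<close>, and row 1 avoids all such cells. Together the two rows still use every column
  and every symbol once.\<close>

definition trade_plex :: "nat \<Rightarrow> (nat \<times> nat) set" where
  "trade_plex k = {(i, j). i < 2 * k \<and> j < 2 * k \<and>
    (if i = 0 then j < k else if i = 1 then k \<le> j else chosen k i (trade_square k i j))}"

text \<open>The trade only permutes entries within lines: column 0 cycles the symbols 0, 1,
  \<open>k\<close> among rows 0, 1, \<open>k\<close>, the columns strictly between 0 and
  \<open>k\<close> swap rows 0 and 1, and column \<open>k\<close> swaps rows 0 and
  \<open>k\<close>.\<close>

lemma latin_trade_square:
  assumes "2 \<le> k"
  shows "latin_square (2 * k) (trade_square k)"
proof (rule latin_squareI)
  fix i j assume "i < 2 * k" "j < 2 * k"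
  then show "trade_square k i j < 2 * k"
    using assms by (auto simp: trade_square_def)
next
  fix i assume i: "i < 2 * k"
  consider "i = 0" | "i = 1" | "i = k" "2 \<le> i" | "2 \<le> i" "i \<noteq> k" by linarith
  then show "inj_on (trade_square k i) {..<2 * k}"
  proof cases
    case 1
    then have "trade_square k i j = (if j < k then j + 1 else if j = k then 0 else j)"
      if "j < 2 * k" for j
      using that assms by (simp add: trade_square_def)
    then show ?thesis by (intro inj_onI) (simp split: if_splits)
  next
    case 2
    then have "trade_square k i j =
        (if j = 0 then k else if j < k then j else if j + 1 = 2 * k then 0 else j + 1)"
      if "j < 2 * k" for j
      using that assms by (simp add: trade_square_def)
    then show ?thesis by (intro inj_onI) (simp split: if_splits)
  next
    case 3
    then have "trade_square k i j =
        (if j = 0 then 0 else if j = k then k else if j < k then k + j else j - k)"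
      if "j < 2 * k" for j
      using that assms by (simp add: trade_square_def)
    then show ?thesis by (intro inj_onI) (simp split: if_splits)
  next
    case 4
    then have "trade_square k i j = (if i + j < 2 * k then i + j else i + j - 2 * k)"
      if "j < 2 * k" for j
      using that assms by (simp add: trade_square_def)
    then show ?thesis by (intro inj_onI) (use i in \<open>simp split: if_splits\<close>)
  qed
next
  fix j assume j: "j < 2 * k"
  consider "j = 0" | "0 < j" "j < k" | "j = k" | "k < j" by linarith
  then show "inj_on (\<lambda>i. trade_square k i j) {..<2 * k}"
  proof cases
    case 1
    then have "trade_square k i j =
        (if i = 0 then 1 else if i = 1 then k else if i = k then 0 else i)"
      if "i < 2 * k" for i
      using that assms by (simp add: trade_square_def)
    then show ?thesis by (intro inj_onI) (use assms in \<open>simp split: if_splits\<close>)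
  next
    case 2
    then have "trade_square k i j =
        (if i = 0 then j + 1 else if i = 1 then j
         else if i + j < 2 * k then i + j else i + j - 2 * k)"
      if "i < 2 * k" for i
      using that assms by (simp add: trade_square_def)
    then show ?thesis by (intro inj_onI) (use 2 in \<open>simp split: if_splits\<close>)
  next
    case 3
    then have "trade_square k i j =
        (if i = 0 then 0 else if i = k then k else if i < k then i + k else i - k)"
      if "i < 2 * k" for i
      using that assms by (simp add: trade_square_def)
    then show ?thesis by (intro inj_onI) (simp split: if_splits)
  next
    case 4
    then have "trade_square k i j = (if i + j < 2 * k then i + j else i + j - 2 * k)"
      if "i < 2 * k" for i
      using that assms by (simp add: trade_square_def)
    then show ?thesis by (intro inj_onI) (use j in \<open>simp split: if_splits\<close>)
  qed
qed

section \<open>Row, symbol and column counts of the plex, and its indivisibility\<close>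

lemma trade_plex_sub: "trade_plex k \<subseteq> {0..<2 * k} \<times> {0..<2 * k}"
  by (auto simp: trade_plex_def)

lemma card_in_half:
  assumes "2 \<le> k"
  shows "card {x. x < 2 * k \<and> (in_half k x \<longleftrightarrow> b)} = k"
proof -
  have T: "{x. x < 2 * k \<and> in_half k x}
      = insert 0 (insert (if even k then k + 1 else k) {k + 2..<2 * k})"
    using assms by (auto simp: in_half_def)
  have ct: "card {x. x < 2 * k \<and> in_half k x} = k"
    unfolding T using assms by (auto simp: card_insert_if)
  have "{x. x < 2 * k \<and> \<not> in_half k x} = {..<2 * k} - {x. x < 2 * k \<and> in_half k x}"
    by auto
  then have "card {x. x < 2 * k \<and> \<not> in_half k x} = k"
    using ct by (simp add: card_Diff_subset subset_iff)
  with ct show ?thesis by (cases b) auto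
qed

text \<open>From row 2 on, the shifted symbol is a permutation of the columns, and the row selects
  either \<open>in_half\<close> or its complement, both of size \<open>k\<close>.\<close>

lemma trade_plex_row:
  assumes "2 \<le> k" "i < 2 * k"
  shows "card {j. (i, j) \<in> trade_plex k} = k"
proof -
  consider "i = 0" | "i = 1" | "2 \<le> i" by linarith
  then show ?thesis
  proof cases
    case 1
    then have "{j. (i, j) \<in> trade_plex k} = {..<k}"
      using assms by (auto simp: trade_plex_def)
    then show ?thesis by simp
  next
    case 2
    then have "{j. (i, j) \<in> trade_plex k} = {k..<2 * k}"
      using assms by (auto simp: trade_plex_def)
    then show ?thesis by simp
  next
    case 3
    let ?u = "i div 2"
    let ?f = "\<lambda>j. shift_down k ?u (trade_square k i j)"
    let ?J = "{j. (i, j) \<in> trade_plex k}"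
    define b where "b \<longleftrightarrow> (even i \<longleftrightarrow> ?u \<le> k div 2)"
    have u: "?u < k" using assms by auto
    have inj: "inj_on ?f {..<2 * k}"
    proof (rule inj_onI)
      fix x y assume xy: "x \<in> {..<2 * k}" "y \<in> {..<2 * k}" "?f x = ?f y"
      have "trade_square k i x < 2 * k" "trade_square k i y < 2 * k"
        using xy assms latin_square_less[OF latin_trade_square] by auto
      then have "trade_square k i x = trade_square k i y"
        using xy(3) u by (auto simp: shift_down_def split: if_splits)
      then show "x = y"
        using xy latin_square_row_inj[OF latin_trade_square[OF assms(1)] assms(2)]
        by (auto simp: inj_on_def)
    qed
    have into: "?f ` {..<2 * k} \<subseteq> {..<2 * k}"
      using u assms latin_square_less[OF latin_trade_square]
      by (auto simp: shift_down_def) (meson less_or_eq_imp_le less_trans diff_le_self le_less_trans)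
    have "?J = {j. j < 2 * k \<and> (in_half k (?f j) \<longleftrightarrow> b)}"
      using 3 assms by (auto simp: trade_plex_def chosen_def b_def)
    then show ?thesis
      using card_permuted[OF inj into, of "\<lambda>x. in_half k x \<longleftrightarrow> b"] card_in_half[OF assms(1)]
      by (simp only:)
  qed
qed

lemma trade_plex_symbol:
  assumes "2 \<le> k" "s < 2 * k"
  shows "card {i. \<exists>j. (i, j) \<in> trade_plex k \<and> trade_square k i j = s} = k"
proof -
  let ?T = "\<lambda>i. \<exists>j. (i, j) \<in> trade_plex k \<and> trade_square k i j = s"
  have T: "?T i \<longleftrightarrow> chosen k i s" if "2 \<le> i" "i < 2 * k" for i
    using that latin_square_row_ex[OF latin_trade_square[OF assms(1)] that(2) assms(2)]
    by (auto simp: trade_plex_def)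
  \<comment> \<open>Rows 0 and 1 are not governed by \<open>chosen\<close>, but their symbol sets
    are complementary as well.\<close>
  have T0: "?T 0 \<longleftrightarrow> 1 \<le> s \<and> s \<le> k"
    using assms by (auto simp: trade_plex_def trade_square_def intro!: exI[of _ "s - 1"])
  have T1: "?T 1 \<longleftrightarrow> s = 0 \<or> k < s"
    using assms
    by (auto simp: trade_plex_def trade_square_def
        intro!: exI[of _ "if s = 0 then 2 * k - 1 else s - 1"] split: if_splits)
  have "{i. ?T i} = {i. i < 2 * k \<and> ?T i}" by (auto simp: trade_plex_def)
  then have "card {i. ?T i} = (\<Sum>u<k. of_bool (?T (2 * u)) + of_bool (?T (2 * u + 1)))"
    by (simp only: card_even_odd)
  also have "\<dots> = (\<Sum>u<k. 1)"
  proof (rule sum.cong)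
    fix u assume u: "u \<in> {..<k}"
    have "?T (2 * u + 1) \<longleftrightarrow> \<not> ?T (2 * u)"
    proof (cases "u = 0")
      case True
      then have "2 * u = 0" "2 * u + 1 = 1" by auto
      then show ?thesis by (simp only: T0 T1) linarith
    next
      case False
      then have "?T (2 * u) \<longleftrightarrow> chosen k (2 * u) s" "?T (2 * u + 1) \<longleftrightarrow> chosen k (2 * u + 1) s"
        using u by (intro T; auto)+
      then show ?thesis by (simp add: chosen_def)
    qed
    then show "of_bool (?T (2 * u)) + of_bool (?T (2 * u + 1)) = (1::nat)"
      by (simp only: of_bool_def) simp
  qed simp
  finally show ?thesis by simp
qed

text \<open>Rows \<open>2u\<close>, \<open>2u + 1\<close> and rows \<open>2(k - u)\<close>, \<open>2(k - u) + 1\<close> together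
  contribute two cells to each column.\<close>
lemma trade_plex_col:
  assumes k: "2 \<le> k" and j: "j < 2 * k"
  shows "card {i. (i, j) \<in> trade_plex k} = k"
proof -
  let ?T = "\<lambda>i. (i, j) \<in> trade_plex k"
  define j' where "j' = (if j + 1 = 2 * k then 0 else j + 1)"
  define v :: "nat \<Rightarrow> nat" where "v u = of_bool (?T (2 * u)) + of_bool (?T (2 * u + 1))" for u
  have v0: "v 0 = 1" using k j by (auto simp: v_def trade_plex_def)
  have shift: "shift_down k u (trade_square k (2 * u) j) = j"
    if "0 < u" "u < k" "2 * u \<noteq> k" for u
  proof -
    have "trade_square k (2 * u) j = (if 2 * u + j < 2 * k then 2 * u + j else 2 * u + j - 2 * k)"
      using that by (simp add: trade_square_def)
    moreover have "2 * u + 2 \<le> 2 * k" using that by simp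
    ultimately show ?thesis using j by (auto simp: shift_down_def)
  qed
  have shift': "shift_down k u (trade_square k (2 * u + 1) j) = j'"
    if "0 < u" "u < k" "\<not> (2 * u + 1 = k \<and> (j = 0 \<or> j = k))" for u
  proof -
    have "trade_square k (2 * u + 1) j
        = (if 2 * u + 1 + j < 2 * k then 2 * u + 1 + j else 2 * u + 1 + j - 2 * k)"
      using that by (auto simp: trade_square_def)
    moreover have "2 * u + 2 \<le> 2 * k" using that by simp
    ultimately show ?thesis using j by (auto simp: shift_down_def j'_def)
  qed
  have even_row: "?T (2 * u) \<longleftrightarrow> (in_half k j \<longleftrightarrow> u \<le> k div 2)"
    if "0 < u" "u < k" "2 * u \<noteq> k" for u
    using shift[OF that] that j by (simp add: trade_plex_def chosen_def)
  have odd_row: "?T (2 * u + 1) \<longleftrightarrow> \<not> (in_half k j' \<longleftrightarrow> u \<le> k div 2)"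
    if "0 < u" "u < k" for u
  proof (cases "2 * u + 1 = k \<and> (j = 0 \<or> j = k)")
    \<comment> \<open>Here row \<open>k\<close> is odd, and the trade exchanges the shifted symbols
      1 and \<open>k + 1\<close>. For odd \<open>k\<close> neither lies in \<open>in_half\<close>,
      so membership is unaffected.\<close>
    case True
    then have "trade_square k (2 * u + 1) j = j" using that by (auto simp: trade_square_def)
    moreover have "\<not> in_half k j'" "odd k" "k div 2 = u"
      using True k by (auto simp: in_half_def j'_def)
    moreover have "\<not> in_half k (shift_down k u j)"
      using True that by (auto simp: in_half_def shift_down_def)
    ultimately show ?thesis using that j by (simp add: trade_plex_def chosen_def)
  next
    case False
    show ?thesis
      using shift'[OF that False] that j by (simp add: trade_plex_def chosen_def)
  qed
  \<comment> \<open>For even \<open>k\<close>, row \<open>k\<close> is an even row. Exchanging its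
    entries in columns 0 and \<open>k\<close> changes membership just as passing from
    \<open>j\<close> to \<open>j'\<close> would, so rows \<open>k\<close> and \<open>k + 1\<close>
    are complementary in every column.\<close>
  have mid_row: "?T (2 * u) \<longleftrightarrow> in_half k j'" if u: "2 * u = k" for u
  proof -
    have S: "trade_square k (2 * u) j =
        (if j = 0 then 0 else if j = k then k else if j < k then k + j else j - k)"
      using u k j by (simp add: trade_square_def)
    have "in_half k (shift_down k u (trade_square k (2 * u) j)) \<longleftrightarrow> in_half k j'"
      unfolding S
    proof -
      consider "j = 0" | "j = k" | "0 < j" "j < k" | "k < j" by linarith
      then show "in_half k (shift_down k u (if j = 0 then 0 else if j = k then k
          else if j < k then k + j else j - k)) \<longleftrightarrow> in_half k j'"
        by cases (use u k j in \<open>auto simp: shift_down_def in_half_def j'_def\<close>)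
    qed
    moreover have "0 < u" "even k" "k div 2 = u" using u k by auto
    ultimately show ?thesis using u j k by (simp add: trade_plex_def chosen_def)
  qed
  have pair: "v u + v (k - u) = 2" if "0 < u" "u < k" for u
  proof (cases "2 * u = k")
    case True
    then have "k - u = u" "u \<le> k div 2" by auto
    then show ?thesis
      using odd_row[of u] mid_row[of u] that True by (simp add: v_def)
  next
    case False
    \<comment> \<open>Exactly one of \<open>u\<close> and \<open>k - u\<close> is at most
      \<open>k div 2\<close>, so each membership condition is counted once with either sign.\<close>
    then have flip: "k - u \<le> k div 2 \<longleftrightarrow> \<not> u \<le> k div 2"
      using that by (cases "even k") (auto elim!: evenE oddE)
    have "0 < k - u" "k - u < k" "2 * (k - u) \<noteq> k" using that False by auto
    note rows = odd_row[OF that] even_row[OF that False] odd_row[OF this(1,2)] even_row[OF this]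
    show ?thesis unfolding v_def rows flip by simp
  qed
  have "(\<Sum>u\<in>{1..<k}. v u) = (\<Sum>u\<in>{1..<k}. v (k - u))"
    by (rule sum.reindex_bij_witness[of _ "\<lambda>u. k - u" "\<lambda>u. k - u"]) auto
  then have "2 * (\<Sum>u\<in>{1..<k}. v u) = (\<Sum>u\<in>{1..<k}. v u + v (k - u))"
    by (simp add: sum.distrib)
  also have "\<dots> = (\<Sum>u\<in>{1..<k}. 2)"
    by (intro sum.cong) (use pair in auto)
  finally have half: "(\<Sum>u\<in>{1..<k}. v u) = k - 1" by simp
  have "{i. ?T i} = {i. i < 2 * k \<and> ?T i}" by (auto simp: trade_plex_def)
  then have "card {i. ?T i} = (\<Sum>u<k. v u)"
    unfolding v_def by (simp only: card_even_odd)
  moreover have "{..<k} = insert 0 {1..<k}" using k by auto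
  ultimately show ?thesis using half v0 k by simp
qed

text \<open>In row 0 the plex cells have symbol \<open>j + 1\<close>, a defect of exactly -1. In row
  1 the plex has only untraded cells, and the trade in row \<open>k\<close> shifts entries by
  \<open>k\<close>.\<close>

lemma trade_plex_delta:
  assumes "2 \<le> k" "(i, j) \<in> trade_plex k"
  shows "int k dvd (int i + int j - int (trade_square k i j)) + of_bool (i = 0)"
proof -
  have "int i + int j - int (trade_square k i j) + of_bool (i = 0) \<in> {0, int k, 2 * int k}"
    using assms by (auto simp: trade_plex_def trade_square_def split: if_splits)
  then show ?thesis by auto
qed

text \<open>Modulo \<open>k\<close>, the Delta lemma counts the cells of a subplex in row 0.\<close>
lemma indivisible_trade_plex:
  assumes k: "2 \<le> k"
  shows "indivisible_plex (2 * k) (trade_square k) k (trade_plex k)"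
  unfolding indivisible_plex_def
proof (intro conjI allI impI notI)
  show "is_plex (2 * k) (trade_square k) k (trade_plex k)"
    by (rule is_plexI[OF trade_plex_sub latin_trade_square])
      (use k trade_plex_row trade_plex_col trade_plex_symbol in auto)
next
  fix c Q
  assume "0 < c \<and> c < k \<and> Q \<subseteq> trade_plex k" and Q: "is_plex (2 * k) (trade_square k) c Q"
  then have c: "0 < c" "c < k" and sub: "Q \<subseteq> trade_plex k" by auto
  have fin: "finite Q"
    by (rule finite_subset[OF subset_trans[OF sub trade_plex_sub]]) simp
  let ?D = "\<lambda>(i, j). int i + int j - int (trade_square k i j)"
  have "int k dvd (\<Sum>x\<in>Q. ?D x + of_bool (fst x = 0))"
    by (rule dvd_sum) (use sub trade_plex_delta[OF k] in fastforce)
  moreover have "(\<Sum>x\<in>Q. of_bool (fst x = 0)) = int c"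
  proof -
    have "(\<Sum>x\<in>Q. of_bool (fst x = 0)) = int (card {x \<in> Q. fst x = 0})"
      using fin by (simp add: sum.If_cases of_bool_def Int_def)
    then show ?thesis using Q k by (simp add: card_row_fibre is_plex_def)
  qed
  \<comment> \<open>The sum of all residues below \<open>2 * k\<close> is an odd multiple of
    \<open>k\<close>; it vanishes modulo \<open>k\<close>, though not modulo
    \<open>2 * k\<close>.\<close>
  moreover have "(\<Sum>x\<in>Q. ?D x) = int c * (int k * (2 * int k - 1))"
  proof -
    have "(\<Sum>y<2 * n. int y) = int n * (2 * int n - 1)" for n
      by (induction n) (auto simp: algebra_simps)
    then show ?thesis using plex_delta_sum[OF Q latin_trade_square[OF k]] by simp
  qed
  ultimately have "int k dvd int c * (int k * (2 * int k - 1)) + int c"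
    by (simp add: sum.distrib)
  then have "int k dvd int c"
    by (simp add: dvd_add_right_iff)
  then show False using c by (auto dest: dvd_imp_le)
qed

section \<open>Bordering a square\<close>

lemma extend_to_permutation:
  fixes f :: "nat \<Rightarrow> nat"
  assumes "inj_on f {..<a}" "f ` {..<a} \<subseteq> {..<r}" "a \<le> r"
  obtains g where "bij_betw g {..<r} {..<r}" "\<And>d. d < a \<Longrightarrow> g d = f d"
proof -
  have "card {a..<r} = card ({..<r} - f ` {..<a})"
    using assms by (simp add: card_Diff_subset card_image)
  then obtain e where e: "bij_betw e {a..<r} ({..<r} - f ` {..<a})"
    using finite_same_card_bij[of "{a..<r}" "{..<r} - f ` {..<a}"] by auto
  define g where "g d = (if d < a then f d else e d)" for d
  have "bij_betw g {..<a} (f ` {..<a})"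
    using assms(1) by (auto simp: bij_betw_def inj_on_def g_def)
  moreover have "bij_betw g {a..<r} ({..<r} - f ` {..<a})"
    using e by (rule bij_betw_cong[THEN iffD1, rotated]) (auto simp: g_def)
  ultimately have "bij_betw g ({..<a} \<union> {a..<r}) (f ` {..<a} \<union> ({..<r} - f ` {..<a}))"
    by (rule bij_betw_combine) auto
  moreover have "{..<a} \<union> {a..<r} = {..<r}" "f ` {..<a} \<union> ({..<r} - f ` {..<a}) = {..<r}"
    using assms by auto
  ultimately show ?thesis using that[of g] by (simp add: g_def)
qed

section \<open>Lines of a bordered square and almost complete mappings\<close>

lemma mod_add_less:
  fixes a b r :: nat
  assumes "a < r" "b < r"
  shows "(a + b) mod r = (if a + b < r then a + b else a + b - r)"
  using assms by (simp add: le_mod_geq)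

lemma mod_add_left_inj:
  fixes a x y r :: nat
  assumes "(a + x) mod r = (a + y) mod r" "a < r" "x < r" "y < r"
  shows "x = y"
  using assms by (auto simp: mod_add_less split: if_splits)

text \<open>Position \<open>z\<close> of the line lies on diagonal \<open>D z\<close>, and a border
  position stands for diagonal \<open>z - m\<close>, one of the last \<open>m\<close>. The small
  symbols thus come from each diagonal once, while the displaced cells get distinct large symbols.
  The form serves both rows and columns.\<close>

lemma inj_on_inner_line:
  fixes p r m :: nat
  assumes p: "p < r" and m: "m \<le> r"
    and D: "\<And>z. z < r \<Longrightarrow> D z < r" "inj_on D {..<r}"
    and G: "bij_betw G {..<r} {..<r}"
    and F: "\<And>z. z < r + m \<Longrightarrow> F z =
      (if z < r then if D z < r - m then (p + G (D z)) mod r else D z + m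
       else (p + G (z - m)) mod r)"
  shows "inj_on F {..<r + m}"
proof (rule inj_onI)
  fix x y assume "x \<in> {..<r + m}" "y \<in> {..<r + m}" and eq: "F x = F y"
  then have x: "x < r + m" and y: "y < r + m" by auto
  define t where "t z = (if z < r then D z else z - m)" for z
  define large where "large z \<longleftrightarrow> z < r \<and> r - m \<le> D z" for z
  have t: "t z < r" if "z < r + m" for z
    using that D(1)[of z] m by (auto simp: t_def)
  have Ft: "F z = (if large z then t z + m else (p + G (t z)) mod r)" if "z < r + m" for z
    using F[OF that] by (auto simp: t_def large_def)
  have F_large: "r \<le> F z \<longleftrightarrow> large z" if "z < r + m" for z
  proof -
    have "(p + G (t z)) mod r < r" using p by simp
    moreover have "large z \<Longrightarrow> r \<le> t z + m" using m by (auto simp: large_def t_def)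
    ultimately show ?thesis using Ft[OF that] by auto
  qed
  have same: "large x \<longleftrightarrow> large y" using F_large[OF x] F_large[OF y] eq by simp
  have "t x = t y"
  proof (cases "large x")
    case True
    then show ?thesis using eq Ft[OF x] Ft[OF y] same by simp
  next
    case False
    then have "(p + G (t x)) mod r = (p + G (t y)) mod r"
      using eq Ft[OF x] Ft[OF y] same by simp
    then have "G (t x) = G (t y)"
      by (rule mod_add_left_inj) (use p t x y G in \<open>auto dest: bij_betw_apply\<close>)
    then show ?thesis using G t x y by (auto simp: bij_betw_def inj_on_def)
  qed
  moreover from this have "x < r \<longleftrightarrow> y < r"
    using same x y m by (auto simp: t_def large_def split: if_splits)
  ultimately show "x = y"
    using x y m by (cases "x < r") (auto simp: t_def intro: inj_onD[OF D(2)])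
qed

lemma inj_on_outer_line:
  fixes c r m :: nat
  assumes c: "c < r" and K: "inj_on K {..<m}"
    and F: "\<And>z. z < r + m \<Longrightarrow> F z = (if z < r then (z + c) mod r else r + K (z - r))"
  shows "inj_on F {..<r + m}"
proof (rule inj_onI)
  fix x y assume "x \<in> {..<r + m}" "y \<in> {..<r + m}" and eq: "F x = F y"
  then have x: "x < r + m" and y: "y < r + m" by auto
  have "r \<le> F z \<longleftrightarrow> r \<le> z" if "z < r + m" for z
    using F[OF that] c by (auto simp: not_le)
  then have same: "r \<le> x \<longleftrightarrow> r \<le> y" using x y eq by metis
  show "x = y"
  proof (cases "x < r")
    case True
    then have "(c + x) mod r = (c + y) mod r" "y < r"
      using eq F[OF x] F[OF y] same by (auto simp: add.commute)
    then show ?thesis using mod_add_left_inj c True by blast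
  next
    case False
    then have K_eq: "K (x - r) = K (y - r)" and "r \<le> y"
      using eq F[OF x] F[OF y] same by auto
    have "x - r = y - r"
      by (rule inj_onD[OF K K_eq]) (use x y False \<open>r \<le> y\<close> in auto)
    then show ?thesis using False \<open>r \<le> y\<close> by simp
  qed
qed

text \<open>An almost complete mapping of the integers modulo \<open>r\<close>: if \<open>r\<close> is even then no complete
  mapping exists, but one element can be spared since \<open>0 < m\<close>.\<close>
lemma ex_near_complete_mapping:
  fixes r m :: nat
  assumes "0 < m" "m \<le> r"
  obtains g h where "bij_betw g {..<r} {..<r}" "bij_betw h {..<r} {..<r}"
    "\<And>d. d < r - m \<Longrightarrow> g d = (d + h d) mod r"
proof -
  \<comment> \<open>For odd \<open>r\<close>, doubling is injective modulo \<open>r\<close>. For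
    even \<open>r\<close>, the sums \<open>d + y d\<close> are even on the first half and odd on the
    second; the overflow of \<open>y\<close> at \<open>d = r - 1\<close> is excluded by
    \<open>0 < m\<close>.\<close>
  define y where "y d = (if even r \<and> r \<le> 2 * d then d + 1 else d)" for d
  define z where "z d = (if d + y d < r then d + y d else d + y d - r)" for d
  have y: "y d < r" if "d < r - m" for d using that assms by (auto simp: y_def)
  have z: "z d < r" if "d < r - m" for d using y[OF that] that by (auto simp: z_def)
  have zmod: "z d = (d + y d) mod r" if "d < r - m" for d
    using y[OF that] that by (simp add: z_def mod_add_less)
  have "inj_on y {..<r - m}"
    by (intro inj_onI) (auto simp: y_def split: if_splits)
  then obtain h where h: "bij_betw h {..<r} {..<r}" "\<And>d. d < r - m \<Longrightarrow> h d = y d"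
    by (rule extend_to_permutation) (use y in auto)
  have "inj_on z {..<r - m}"
  proof (rule inj_onI)
    fix a b assume "a \<in> {..<r - m}" "b \<in> {..<r - m}" "z a = z b"
    then have "a < r" "b < r" "z a = z b" by auto
    then show "a = b"
      unfolding z_def y_def by (simp split: if_splits) presburger+
  qed
  then obtain g where g: "bij_betw g {..<r} {..<r}" "\<And>d. d < r - m \<Longrightarrow> g d = z d"
    by (rule extend_to_permutation) (use z in auto)
  show ?thesis
    by (rule that[OF g(1) h(1)]) (simp add: g(2) h(2) zmod)
qed

text \<open>Rows, columns and symbols from \<open>r\<close> on carry a copy of a square \<open>L\<close> of order \<open>m\<close>. On the
  other rows and columns, the \<open>d\<close>-th cyclic diagonal is a transversal in the small symbols if
  \<open>d < r - m\<close>, and carries a single large symbol otherwise.\<close>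
locale bordering =
  fixes r m :: nat and g h :: "nat \<Rightarrow> nat" and L :: "nat \<Rightarrow> nat \<Rightarrow> nat"
  assumes m_le: "m \<le> r"
    and g_bij: "bij_betw g {..<r} {..<r}"
    and h_bij: "bij_betw h {..<r} {..<r}"
    and g_eq: "\<And>d. d < r - m \<Longrightarrow> g d = (d + h d) mod r"
    and latin: "latin_square m L"
begin

definition diag :: "nat \<Rightarrow> nat \<Rightarrow> nat" where
  "diag i j = (if i \<le> j then j - i else j + r - i)"

text \<open>The border receives what the last \<open>m\<close> diagonals give up: column
  \<open>j\<close> from \<open>r\<close> on holds the entries that \<open>g\<close> would put on
  diagonal \<open>j - m\<close>, and the rows from \<open>r\<close> on use \<open>h\<close> in the
  same way.\<close>

definition bordered :: "nat \<Rightarrow> nat \<Rightarrow> nat" where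
  "bordered i j =
    (if i < r then
       if j < r then if diag i j < r - m then (i + g (diag i j)) mod r else diag i j + m
       else (i + g (j - m)) mod r
     else if j < r then (j + h (i - m)) mod r
     else r + L (i - r) (j - r))"

definition bordered_plex :: "nat \<Rightarrow> (nat \<times> nat) set \<Rightarrow> (nat \<times> nat) set" where
  "bordered_plex k P = {(i, j). i < r \<and> j < r \<and> diag i j < k}
    \<union> {(i, j). r \<le> i \<and> r \<le> j \<and> (i - r, j - r) \<in> P}"

section \<open>Latin property and plexes of the bordered square\<close>

lemma g_less: "x < r \<Longrightarrow> g x < r" and h_less: "x < r \<Longrightarrow> h x < r"
  using g_bij h_bij by (auto dest: bij_betw_apply)

lemma g_inj: "g x = g y \<Longrightarrow> x < r \<Longrightarrow> y < r \<Longrightarrow> x = y"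
  using g_bij by (auto simp: bij_betw_def inj_on_def)

lemma diag_less: "i < r \<Longrightarrow> j < r \<Longrightarrow> diag i j < r"
  by (auto simp: diag_def)

lemma diag_row_inj: "diag i j = diag i j' \<Longrightarrow> i < r \<Longrightarrow> j < r \<Longrightarrow> j' < r \<Longrightarrow> j = j'"
  and diag_col_inj: "diag i j = diag i' j \<Longrightarrow> i < r \<Longrightarrow> i' < r \<Longrightarrow> j < r \<Longrightarrow> i = i'"
  by (auto simp: diag_def split: if_splits)

lemma row_plus_diag: "i < r \<Longrightarrow> j < r \<Longrightarrow> (i + diag i j) mod r = j"
  by (auto simp: diag_def)

text \<open>With \<open>d = diag i j\<close> the column is \<open>i + d\<close> modulo
  \<open>r\<close>, and \<open>g d\<close> is \<open>d + h d\<close>. Hence \<open>h\<close> plays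
  for columns the role of \<open>g\<close> for rows.\<close>

lemma transversal_by_col:
  assumes "i < r" "j < r" "diag i j < r - m"
  shows "(i + g (diag i j)) mod r = (j + h (diag i j)) mod r"
proof -
  have "(i + g (diag i j)) mod r = (i + diag i j + h (diag i j)) mod r"
    using g_eq[OF assms(3)] by (simp add: mod_simps add.assoc)
  also have "\<dots> = ((i + diag i j) mod r + h (diag i j)) mod r" by (simp add: mod_simps)
  finally show ?thesis using row_plus_diag assms by simp
qed

lemma latin_bordered: "latin_square (r + m) bordered"
proof (rule latin_squareI)
  fix i j assume "i < r + m" "j < r + m"
  then show "bordered i j < r + m"
    using m_le diag_less[of i j] latin_square_less[OF latin, of "i - r" "j - r"]
    by (auto simp: bordered_def intro: trans_less_add1)
next
  fix i assume i: "i < r + m"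
  show "inj_on (bordered i) {..<r + m}"
  proof (cases "i < r")
    case True
    show ?thesis
    proof (rule inj_on_inner_line[OF True m_le _ _ g_bij])
      show "inj_on (diag i) {..<r}" using diag_row_inj True by (auto intro: inj_onI)
    qed (use True diag_less in \<open>auto simp: bordered_def\<close>)
  next
    case False
    have "h (i - m) < r" by (rule h_less) (use i False m_le in auto)
    then show ?thesis
      by (rule inj_on_outer_line[OF _ latin_square_row_inj[OF latin, of "i - r"]])
        (use i False in \<open>auto simp: bordered_def\<close>)
  qed
next
  fix j assume j: "j < r + m"
  show "inj_on (\<lambda>i. bordered i j) {..<r + m}"
  proof (cases "j < r")
    case True
    show ?thesis
    proof (rule inj_on_inner_line[OF True m_le _ _ h_bij])
      show "inj_on (\<lambda>i. diag i j) {..<r}" using diag_col_inj True by (auto intro: inj_onI)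
    qed (use True diag_less transversal_by_col in \<open>auto simp: bordered_def\<close>)
  next
    case False
    have "g (j - m) < r" by (rule g_less) (use j False m_le in auto)
    then show ?thesis
      by (rule inj_on_outer_line[OF _ latin_square_col_inj[OF latin, of "j - r"]])
        (use j False in \<open>auto simp: bordered_def\<close>)
  qed
qed

lemma is_plex_bordered:
  assumes P: "is_plex m L k P" and k: "k \<le> r - m"
  shows "is_plex (r + m) bordered k (bordered_plex k P)"
proof (rule is_plexI[OF _ latin_bordered])
  have sub: "P \<subseteq> {0..<m} \<times> {0..<m}" using P by (simp add: is_plex_def)
  then show "bordered_plex k P \<subseteq> {0..<r + m} \<times> {0..<r + m}"
    using m_le by (auto simp: bordered_plex_def)
  have kr: "k \<le> r" using k by simp
  then have segment: "{d. d < r \<and> d < k} = {..<k}" by auto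
  show "card {j. (i, j) \<in> bordered_plex k P} = k" if i: "i < r + m" for i
  proof (cases "i < r")
    case True
    then have "{j. (i, j) \<in> bordered_plex k P} = {j. j < r \<and> diag i j < k}"
      by (auto simp: bordered_plex_def)
    also have "card \<dots> = card {d. d < r \<and> d < k}"
      by (rule card_permuted) (use True diag_less diag_row_inj in \<open>auto intro: inj_onI\<close>)
    finally show ?thesis using kr by (simp add: segment)
  next
    case False
    then have "{j. (i, j) \<in> bordered_plex k P} = {j. r \<le> j \<and> (i - r, j - r) \<in> P}"
      by (auto simp: bordered_plex_def)
    then show ?thesis
      using P False i card_translated[of r "\<lambda>b. (i - r, b) \<in> P"] by (simp add: is_plex_def)
  qed
  show "card {i. (i, j) \<in> bordered_plex k P} = k" if j: "j < r + m" for j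
  proof (cases "j < r")
    case True
    then have "{i. (i, j) \<in> bordered_plex k P} = {i. i < r \<and> diag i j < k}"
      by (auto simp: bordered_plex_def)
    also have "card \<dots> = card {d. d < r \<and> d < k}"
      by (rule card_permuted) (use True diag_less diag_col_inj in \<open>auto intro: inj_onI\<close>)
    finally show ?thesis using kr by (simp add: segment)
  next
    case False
    then have "{i. (i, j) \<in> bordered_plex k P} = {i. r \<le> i \<and> (i - r, j - r) \<in> P}"
      by (auto simp: bordered_plex_def)
    then show ?thesis
      using P False j card_translated[of r "\<lambda>a. (a, j - r) \<in> P"] by (simp add: is_plex_def)
  qed
  show "card {i. \<exists>j. (i, j) \<in> bordered_plex k P \<and> bordered i j = s} = k" if s: "s < r + m" for s
  proof (cases "s < r")
    case True
    \<comment> \<open>\<open>f d\<close> is the row, \<open>s - g d\<close> modulo \<open>r\<close>,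
      in which transversal \<open>d\<close> carries \<open>s\<close>; injectivity of
      \<open>g\<close> makes these rows distinct.\<close>
    define f where "f d = (if g d \<le> s then s - g d else s + r - g d)" for d
    have f: "i < r \<and> (i + g d) mod r = s \<longleftrightarrow> i = f d" if "d < k" for i d
    proof -
      have gd: "g d < r" by (rule g_less) (use that kr in simp)
      then show ?thesis
        using True by (cases "i < r") (auto simp: f_def mod_add_less)
    qed
    have "{i. \<exists>j. (i, j) \<in> bordered_plex k P \<and> bordered i j = s} = f ` {..<k}" (is "?A = _")
    proof (intro equalityI subsetI)
      fix i assume "i \<in> ?A"
      then obtain j where "i < r" "j < r" "diag i j < k" "bordered i j = s"
        using True by (auto simp: bordered_plex_def bordered_def)
      then show "i \<in> f ` {..<k}"
        using f[of "diag i j" i] k by (auto simp: bordered_def)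
    next
      fix i assume "i \<in> f ` {..<k}"
      then obtain d where d: "d < k" "i = f d" by auto
      then have i: "i < r" "(i + g d) mod r = s" using f by auto
      define j where "j = (if i + d < r then i + d else i + d - r)"
      have "j < r" "diag i j = d" using i d kr by (auto simp: j_def diag_def)
      then have "(i, j) \<in> bordered_plex k P" "bordered i j = s"
        using i d k by (auto simp: bordered_plex_def bordered_def)
      then show "i \<in> ?A" by blast
    qed
    moreover have "inj_on f {..<k}"
    proof (rule inj_onI)
      fix x y assume "x \<in> {..<k}" "y \<in> {..<k}" and eq: "f x = f y"
      then have xy: "x < r" "y < r" using kr by auto
      have "g x = g y"
        using eq g_less[OF xy(1)] g_less[OF xy(2)] True by (simp add: f_def split: if_splits)
      then show "x = y" by (rule g_inj[OF _ xy])
    qed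
    ultimately show ?thesis by (simp add: card_image)
  next
    case False
    then have sm: "s - r < m" using s by simp
    have "bordered i j < r" if "i < r" "j < r" "diag i j < k" for i j
      using that k by (auto simp: bordered_def)
    then have "{i. \<exists>j. (i, j) \<in> bordered_plex k P \<and> bordered i j = s}
        = (+) r ` {a. \<exists>b. (a, b) \<in> P \<and> L a b = s - r}" (is "?A = ?B")
    proof (intro equalityI subsetI)
      fix i assume "i \<in> ?B"
      then obtain a b where "(a, b) \<in> P" "L a b = s - r" "i = r + a" by auto
      then have "(i, r + b) \<in> bordered_plex k P" "bordered i (r + b) = s"
        using False by (auto simp: bordered_plex_def bordered_def)
      then show "i \<in> ?A" by blast
    next
      fix i assume small: "\<And>i j. i < r \<Longrightarrow> j < r \<Longrightarrow> diag i j < k \<Longrightarrow> bordered i j < r"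
        and "i \<in> ?A"
      then obtain j where "(i, j) \<in> bordered_plex k P" "bordered i j = s" by auto
      then have "r \<le> i" "(i - r, j - r) \<in> P" "L (i - r) (j - r) = s - r"
        using small[of i j] False by (auto simp: bordered_plex_def bordered_def)
      then show "i \<in> ?B" by (force simp: image_iff)
    qed
    then show ?thesis
      using P sm card_symbol_cells[OF latin sub] by (simp add: card_image is_plex_def)
  qed
qed

text \<open>The first \<open>k\<close> diagonals carry small symbols only, so large rows, columns
  and symbols meet the plex just in the copy of \<open>P\<close>. Any \<open>c\<close>-plex inside
  it therefore restricts to a \<open>c\<close>-plex of \<open>L\<close> inside
  \<open>P\<close>.\<close>

lemma indivisible_bordered:
  assumes P: "indivisible_plex m L k P" and k: "k \<le> r - m"
  shows "indivisible_plex (r + m) bordered k (bordered_plex k P)"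
  unfolding indivisible_plex_def
proof (intro conjI allI impI notI)
  show "is_plex (r + m) bordered k (bordered_plex k P)"
    using P k by (intro is_plex_bordered) (auto simp: indivisible_plex_def)
next
  fix c Q
  assume c: "0 < c \<and> c < k \<and> Q \<subseteq> bordered_plex k P" and Q: "is_plex (r + m) bordered c Q"
  define Q' where "Q' = {(a, b). (r + a, r + b) \<in> Q}"
  have sub: "P \<subseteq> {0..<m} \<times> {0..<m}"
    using P by (simp add: indivisible_plex_def is_plex_def)
  have Q'P: "Q' \<subseteq> P" using c by (auto simp: Q'_def bordered_plex_def)
  have small: "bordered i j < r" if "(i, j) \<in> Q" "i < r" for i j
    using that c k by (auto simp: bordered_plex_def bordered_def)
  have Q_iff: "(i, j) \<in> Q \<and> r \<le> i \<longleftrightarrow> (\<exists>a b. i = r + a \<and> j = r + b \<and> (a, b) \<in> Q')"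
    "(i, j) \<in> Q \<and> r \<le> j \<longleftrightarrow> (\<exists>a b. i = r + a \<and> j = r + b \<and> (a, b) \<in> Q')" for i j
    using c by (auto simp: Q'_def bordered_plex_def le_iff_add)
  have "is_plex m L c Q'"
  proof (rule is_plexI[OF _ latin])
    show "Q' \<subseteq> {0..<m} \<times> {0..<m}" using Q'P sub by blast
    show "card {b. (a, b) \<in> Q'} = c" if "a < m" for a
    proof -
      have "{j. (r + a, j) \<in> Q} = (+) r ` {b. (a, b) \<in> Q'}"
        using Q_iff(1)[of "r + a"] by auto
      moreover have "card {j. (r + a, j) \<in> Q} = c" using Q that by (simp add: is_plex_def)
      ultimately show ?thesis by (simp add: card_image)
    qed
    show "card {a. (a, b) \<in> Q'} = c" if "b < m" for b
    proof -
      have "{i. (i, r + b) \<in> Q} = (+) r ` {a. (a, b) \<in> Q'}"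
        using Q_iff(2)[of _ "r + b"] by auto
      moreover have "card {i. (i, r + b) \<in> Q} = c" using Q that by (simp add: is_plex_def)
      ultimately show ?thesis by (simp add: card_image)
    qed
    show "card {a. \<exists>b. (a, b) \<in> Q' \<and> L a b = s} = c" if s: "s < m" for s
    proof -
      have "{i. \<exists>j. (i, j) \<in> Q \<and> bordered i j = r + s} = (+) r ` {a. \<exists>b. (a, b) \<in> Q' \<and> L a b = s}"
        (is "?A = ?B")
      proof (intro equalityI subsetI)
        fix i assume "i \<in> ?A"
        then obtain j where j: "(i, j) \<in> Q" "bordered i j = r + s" by auto
        then have "r \<le> i" using small[of i j] by force
        then obtain a b where "i = r + a" "j = r + b" "(a, b) \<in> Q'" using j Q_iff(1) by blast
        then show "i \<in> ?B" using j by (auto simp: bordered_def)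
      next
        fix i assume "i \<in> ?B"
        then obtain a b where "i = r + a" "(a, b) \<in> Q'" "L a b = s" by auto
        then have "(i, r + b) \<in> Q" "bordered i (r + b) = r + s"
          by (auto simp: Q'_def bordered_def)
        then show "i \<in> ?A" by blast
      qed
      moreover have "Q \<subseteq> {0..<r + m} \<times> {0..<r + m}" using Q by (simp add: is_plex_def)
      then have "card {i. \<exists>j. (i, j) \<in> Q \<and> bordered i j = r + s} = c"
        using Q s card_symbol_cells[OF latin_bordered, of Q "r + s"] by (simp add: is_plex_def)
      ultimately show ?thesis by (simp add: card_image)
    qed
  qed
  then show False using P c Q'P by (auto simp: indivisible_plex_def)
qed

end

lemma ex_indivisible_plex_bordered:
  assumes "latin_square m L" "indivisible_plex m L k P" "0 < m" "2 * m + k \<le> n"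
  shows "\<exists>L P. latin_square n L \<and> indivisible_plex n L k P"
proof -
  define r where "r = n - m"
  have r: "m \<le> r" "k \<le> r - m" "n = r + m" using assms(4) by (auto simp: r_def)
  obtain g h where "bij_betw g {..<r} {..<r}" "bij_betw h {..<r} {..<r}"
    "\<And>d. d < r - m \<Longrightarrow> g d = (d + h d) mod r"
    using ex_near_complete_mapping[OF assms(3) r(1)] by blast
  then interpret bordering r m g h L
    by unfold_locales (use r assms in auto)
  show ?thesis
    using latin_bordered indivisible_bordered[OF assms(2) r(2)] r(3) by blast
qed

theorem theorem5p5:
  fixes n k :: nat
  assumes "0 < n" and "0 < k" and "5 * k \<le> n"
  shows "\<exists>L P. latin_square n L \<and> indivisible_plex n L k P"
proof (cases "k = 1")
  case True
  have latin: "latin_square 1 (\<lambda>i j. 0)"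
    by (rule latin_squareI) (auto simp: inj_on_def)
  have "is_plex 1 (\<lambda>i j. 0) 1 {(0, 0)}"
    by (rule is_plexI[OF _ latin]) auto
  \<comment> \<open>Indivisibility is vacuous, as no \<open>c\<close> satisfies \<open>0 < c\<close>
    and \<open>c < 1\<close>.\<close>
  then have "indivisible_plex 1 (\<lambda>i j. 0) k {(0, 0)}"
    using True by (simp add: indivisible_plex_def)
  then show ?thesis
    by (rule ex_indivisible_plex_bordered[OF latin]) (use assms True in auto)
next
  case False
  then have "2 \<le> k" using assms by simp
  then show ?thesis
    by (intro ex_indivisible_plex_bordered[OF latin_trade_square indivisible_trade_plex])
      (use assms in auto)
qed

end
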